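(* Let $X$ be an infinite-dimensional complex Hilbert space and let $A\in\mathcal{B}(X)$ be generalized Drazin invertible. Then the system of equations $$AB^2=B\quad\text{and}\quad AB=A^{\mathrm{cEP}}A$$ in the unknown $B\in\mathcal{B}(X)$ is consistent and it has the unique solution given by $$B=\begin{bmatrix}A_1^{-1}&A_1^{-2}A_2\\0&0\end{bmatrix}:\begin{bmatrix}R(A^d)\\N[(A^d)^*]\end{bmatrix}\to\begin{bmatrix}R(A^d)\\N[(A^d)^*]\end{bmatrix},$$ where $$A=\begin{bmatrix}A_1&A_2\\0&A_3\end{bmatrix}:\begin{bmatrix}R(A^d)\\N[(A^d)^*]\end{bmatrix}\to\begin{bmatrix}R(A^d)\\N[(A^d)^*]\end{bmatrix},$$ $A_1\in\mathcal{B}(R(A^d))$ is invertible and $A_3\in\mathcal{B}(N[(A^d)^*])$ is quasinilpotent.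
   Context: $\mathcal{B}(X)$ is the set of bounded linear operators on $X$; $R(\cdot)$, $N(\cdot)$, $(\cdot)^*$ denote range, null space and adjoint; $P_L$ is the orthogonal projector onto a closed subspace $L$. $A\in\mathcal{B}(X)$ is generalized Drazin invertible if there is a (necessarily unique) $A^d\in\mathcal{B}(X)$ with $AA^d=A^dA$, $A^dAA^d=A^d$ and $A-A^2A^d$ quasinilpotent. The core-EP inverse $A^{\mathrm{cEP}}$ of such $A$ is the unique (it exists) operator $B\in\mathcal{B}(X)$ with $AB=P_{R(A^d)}$ and $R(B)\subseteq R(A^d)$. That $A$ has the displayed block form with respect to the orthogonal decomposition $X=R(A^d)\oplus N[(A^d)^*]$, with $A_1$ invertible and $A_3$ quasinilpotent, is a known fact. *)

theory Defs
  imports "HOL-Analysis.Analysis"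
begin

section \<open>Complex Hilbert spaces\<close>

class complex_vector = real_vector +
  fixes scaleC :: "complex \<Rightarrow> 'a \<Rightarrow> 'a" (infixr "*\<^sub>C" 75)
  assumes scaleC_add_right: "a *\<^sub>C (x + y) = a *\<^sub>C x + a *\<^sub>C y"
    and scaleC_add_left: "(a + b) *\<^sub>C x = a *\<^sub>C x + b *\<^sub>C x"
    and scaleC_scaleC: "a *\<^sub>C (b *\<^sub>C x) = (a * b) *\<^sub>C x"
    and scaleC_one: "1 *\<^sub>C x = x"
    and scaleR_scaleC: "r *\<^sub>R x = complex_of_real r *\<^sub>C x"

global_interpretation complex_vector:
  vector_space "scaleC :: complex \<Rightarrow> 'a \<Rightarrow> 'a::complex_vector"
  by unfold_locales (rule scaleC_add_right scaleC_add_left scaleC_scaleC scaleC_one)+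

text \<open>The inner product is linear in its first argument. The norm, metric and topology are the
  library's; the last axiom ties them to the inner product.\<close>

class complex_inner = complex_vector + real_normed_vector +
  fixes cinner :: "'a \<Rightarrow> 'a \<Rightarrow> complex"
  assumes cinner_commute: "cinner x y = cnj (cinner y x)"
    and cinner_add_left: "cinner (x + y) z = cinner x z + cinner y z"
    and cinner_scaleC_left: "cinner (c *\<^sub>C x) y = c * cinner x y"
    and cinner_ge_zero: "0 \<le> Re (cinner x x)"
    and cinner_eq_zero_iff: "cinner x x = 0 \<longleftrightarrow> x = 0"
    and norm_eq_sqrt_cinner: "norm x = sqrt (Re (cinner x x))"

class chilbert_space = complex_inner + complete_space


section \<open>Bounded operators between subspaces\<close>

text \<open>An operator from a subspace \<open>L\<close> to a subspace \<open>M\<close> is represented by a function on the whole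
  space of which only the values on \<open>L\<close> matter. In particular, \<open>bop UNIV UNIV\<close> is the set of all
  bounded linear operators on the space.\<close>

definition bop :: "'a::chilbert_space set \<Rightarrow> 'a set \<Rightarrow> ('a \<Rightarrow> 'a) set" where
  "bop L M = {T. T ` L \<subseteq> M
     \<and> (\<forall>x\<in>L. \<forall>y\<in>L. T (x + y) = T x + T y)
     \<and> (\<forall>c. \<forall>x\<in>L. T (c *\<^sub>C x) = c *\<^sub>C T x)
     \<and> (\<exists>K. \<forall>x\<in>L. norm (T x) \<le> K * norm x)}"

lemma bop_UNIV_iff:
  "T \<in> bop UNIV UNIV \<longleftrightarrow> bounded_linear T \<and> (\<forall>c x. T (c *\<^sub>C x) = c *\<^sub>C T x)"
proof
  assume T: "T \<in> bop UNIV UNIV"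
  then obtain K where "\<forall>x. norm (T x) \<le> K * norm x" by (auto simp: bop_def)
  then have "bounded_linear T"
    using T by (intro bounded_linear_intro[where K = K]) 
      (auto simp: bop_def scaleR_scaleC mult.commute)
  with T show "bounded_linear T \<and> (\<forall>c x. T (c *\<^sub>C x) = c *\<^sub>C T x)"
    by (auto simp: bop_def)
next
  assume T: "bounded_linear T \<and> (\<forall>c x. T (c *\<^sub>C x) = c *\<^sub>C T x)"
  then interpret bounded_linear T by simp
  show "T \<in> bop UNIV UNIV"
    using T bounded by (auto simp: bop_def add mult.commute)
qed

definition invertible_on :: "'a::chilbert_space set \<Rightarrow> ('a \<Rightarrow> 'a) \<Rightarrow> bool" where
  "invertible_on L T \<longleftrightarrow> (\<exists>S\<in>bop L L. \<forall>x\<in>L. S (T x) = x \<and> T (S x) = x)"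

definition spectrum_on :: "'a::chilbert_space set \<Rightarrow> ('a \<Rightarrow> 'a) \<Rightarrow> complex set" where
  "spectrum_on L T = {z. \<not> invertible_on L (\<lambda>x. z *\<^sub>C x - T x)}"

text \<open>Inclusion rather than equality: on the zero space the spectrum is empty, and the only
  operator there counts as quasinilpotent.\<close>

definition quasinilpotent_on :: "'a::chilbert_space set \<Rightarrow> ('a \<Rightarrow> 'a) \<Rightarrow> bool" where
  "quasinilpotent_on L T \<longleftrightarrow> spectrum_on L T \<subseteq> {0}"

definition null_space :: "('a::chilbert_space \<Rightarrow> 'a) \<Rightarrow> 'a set" where
  "null_space T = {x. T x = 0}"

definition cadjoint :: "('a::chilbert_space \<Rightarrow> 'a) \<Rightarrow> ('a \<Rightarrow> 'a)" where
  "cadjoint T = (THE S. S \<in> bop UNIV UNIV \<and> (\<forall>x y. cinner (T x) y = cinner x (S y)))"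


section \<open>Orthogonal decompositions and operator matrices\<close>

definition orth_proj :: "'a::chilbert_space set \<Rightarrow> 'a \<Rightarrow> 'a" where
  "orth_proj L x = (THE u. u \<in> L \<and> (\<forall>y\<in>L. cinner (x - u) y = 0))"

definition orth_decomposition :: "'a::chilbert_space set \<Rightarrow> 'a set \<Rightarrow> bool" where
  "orth_decomposition L M \<longleftrightarrow>
     complex_vector.subspace L \<and> closed L \<and> complex_vector.subspace M \<and> closed M
     \<and> (\<forall>u\<in>L. \<forall>v\<in>M. cinner u v = 0) \<and> (\<forall>x. \<exists>u\<in>L. \<exists>v\<in>M. x = u + v)"

text \<open>The operator given by the matrix with rows \<open>(T11, T12)\<close> and \<open>(T21, T22)\<close> with respect to
  \<open>L \<oplus> M\<close>, for an orthogonal decomposition of the space into \<open>L\<close> and \<open>M\<close>.\<close>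

definition block_op :: "'a::chilbert_space set \<Rightarrow> 'a set \<Rightarrow>
    ('a \<Rightarrow> 'a) \<Rightarrow> ('a \<Rightarrow> 'a) \<Rightarrow> ('a \<Rightarrow> 'a) \<Rightarrow> ('a \<Rightarrow> 'a) \<Rightarrow> ('a \<Rightarrow> 'a)" where
  "block_op L M T11 T12 T21 T22 = (\<lambda>x.
     let u = orth_proj L x; v = orth_proj M x
     in (T11 u + T12 v) + (T21 u + T22 v))"


section \<open>Generalized Drazin and core-EP inverses\<close>

definition is_gdrazin_inverse :: "('a::chilbert_space \<Rightarrow> 'a) \<Rightarrow> ('a \<Rightarrow> 'a) \<Rightarrow> bool" where
  "is_gdrazin_inverse A D \<longleftrightarrow> D \<in> bop UNIV UNIV
     \<and> A \<circ> D = D \<circ> A \<and> D \<circ> A \<circ> D = D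
     \<and> quasinilpotent_on UNIV (\<lambda>x. A x - (A ^^ 2) (D x))"

definition gdrazin_invertible :: "('a::chilbert_space \<Rightarrow> 'a) \<Rightarrow> bool" where
  "gdrazin_invertible A \<longleftrightarrow> (\<exists>D. is_gdrazin_inverse A D)"

definition gdrazin :: "('a::chilbert_space \<Rightarrow> 'a) \<Rightarrow> ('a \<Rightarrow> 'a)" where
  "gdrazin A = (THE D. is_gdrazin_inverse A D)"

definition core_EP :: "('a::chilbert_space \<Rightarrow> 'a) \<Rightarrow> ('a \<Rightarrow> 'a)" where
  "core_EP A = (THE B. B \<in> bop UNIV UNIV
     \<and> A \<circ> B = orth_proj (range (gdrazin A)) \<and> range B \<subseteq> range (gdrazin A))"

definition core_EP_form ::
    "('a::chilbert_space \<Rightarrow> 'a) \<Rightarrow> ('a \<Rightarrow> 'a) \<Rightarrow> ('a \<Rightarrow> 'a) \<Rightarrow> ('a \<Rightarrow> 'a) \<Rightarrow> bool" where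
  "core_EP_form A A1 A2 A3 \<longleftrightarrow>
     (let L = range (gdrazin A); M = null_space (cadjoint (gdrazin A))
      in A1 \<in> bop L L \<and> A2 \<in> bop M L \<and> A3 \<in> bop M M
         \<and> A = block_op L M A1 A2 (\<lambda>_. 0) A3
         \<and> invertible_on L A1 \<and> quasinilpotent_on M A3)"

end

theory Submission
  imports Defs "HOL-Complex_Analysis.Conformal_Mappings"
begin

text \<open>Put \<open>D = A\<^sup>d\<close>, \<open>L = R(D)\<close> and \<open>M = L\<^sup>\<bottom> = N(D\<^sup>*)\<close>. On \<open>L\<close> the operators \<open>A\<close> and \<open>D\<close> are inverse
  to each other, so the core-EP inverse is \<open>D P\<^sub>L\<close>, and the only solution of the system is
  \<open>D\<^sup>2 P\<^sub>L A\<close>. The analytic content is the uniqueness of \<open>D\<close>, which is needed for \<open>A\<^sup>d\<close> to be defined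
  and rests on Liouville's theorem because quasinilpotency is expressed by the spectrum.\<close>

section \<open>Inner product and orthogonal projection\<close>

text \<open>Quasinilpotency only says that z - Q has a bounded inverse for every z other than 0, so
  the resolvent is the sole handle on it; pairing it with a functional keeps the complex analysis
  scalar-valued. For two candidates D and D' this gives a relation between the idempotents P = DA
  and P' = D'A: the kernel of P' lies in that of P. Exchanging D and D' compares kernels again,
  never ranges, and an idempotent is determined only by both. The missing range inclusion comes from
  the same argument for the adjoints. Thus P'P equals both P' and P, and D = D' follows from D =
  DAD. Hence adjoints, and with them Riesz representation and orthogonal projection, serve
  uniqueness as well as the description of M. As functions on the whole space the entries of a block
  form are not unique, so every admissible triple has to be shown to yield the same
  operator.\<close>

lemma cinner_add_right: "cinner x (y + z) = cinner x y + cinner x z"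
  for x y z :: "'a::complex_inner"
  by (metis cinner_commute cinner_add_left complex_cnj_add)

lemma cinner_scaleC_right: "cinner x (c *\<^sub>C y) = cnj c * cinner x y"
  for x y :: "'a::complex_inner"
  by (metis cinner_commute cinner_scaleC_left complex_cnj_mult)

lemma cinner_0_left [simp]: "cinner 0 y = 0" for y :: "'a::complex_inner"
  using cinner_scaleC_left[of 0 0 y] by simp

lemma cinner_0_right [simp]: "cinner x 0 = 0" for x :: "'a::complex_inner"
  using cinner_scaleC_right[of x 0 0] by simp

lemma cinner_diff_left: "cinner (x - y) z = cinner x z - cinner y z"
  for x y z :: "'a::complex_inner"
  using cinner_add_left[of "x - y" y z] by simp

lemma cinner_diff_right: "cinner x (y - z) = cinner x y - cinner x z"
  for x y z :: "'a::complex_inner"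
  using cinner_add_right[of x "y - z" z] by simp

lemmas cinner_simps = cinner_add_left cinner_add_right cinner_diff_left cinner_diff_right
  cinner_scaleC_left cinner_scaleC_right

lemma cinner_self: "cinner x x = complex_of_real ((norm x)\<^sup>2)" for x :: "'a::complex_inner"
proof -
  have "Im (cinner x x) = 0"
    using arg_cong[OF cinner_commute[of x x], of Im] by simp
  moreover have "Re (cinner x x) = (norm x)\<^sup>2"
    by (simp add: norm_eq_sqrt_cinner cinner_ge_zero)
  ultimately show ?thesis by (simp add: complex_eq_iff)
qed

lemma norm_sq_diff:
  fixes x y :: "'a::complex_inner"
  shows "(norm (x - y))\<^sup>2 = (norm x)\<^sup>2 + (norm y)\<^sup>2 - 2 * Re (cinner x y)"
proof -
  have "Re (cinner y x) = Re (cinner x y)"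
    by (subst cinner_commute) simp
  then have "Re (cinner (x - y) (x - y)) = Re (cinner x x) + Re (cinner y y) - 2 * Re (cinner x y)"
    by (simp add: cinner_simps)
  then show ?thesis by (simp add: cinner_self)
qed

lemma norm_sq_add:
  fixes x y :: "'a::complex_inner"
  shows "(norm (x + y))\<^sup>2 = (norm x)\<^sup>2 + (norm y)\<^sup>2 + 2 * Re (cinner x y)"
proof -
  have "cinner x (- y) = - cinner x y"
    using cinner_diff_right[of x 0 y] by simp
  then show ?thesis
    using norm_sq_diff[of x "- y"] by simp
qed

lemma parallelogram_law:
  fixes x y :: "'a::complex_inner"
  shows "(norm (x + y))\<^sup>2 + (norm (x - y))\<^sup>2 = 2 * (norm x)\<^sup>2 + 2 * (norm y)\<^sup>2"
  by (simp add: norm_sq_diff norm_sq_add)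

lemma norm_scaleC: "norm (c *\<^sub>C x) = cmod c * norm x" for x :: "'a::complex_inner"
proof -
  have "complex_of_real ((norm (c *\<^sub>C x))\<^sup>2) = complex_of_real ((cmod c * norm x)\<^sup>2)"
    unfolding cinner_self[symmetric] cinner_scaleC_left cinner_scaleC_right
    using complex_norm_square[of c] by (simp add: cinner_self power_mult_distrib mult_ac)
  then have "(norm (c *\<^sub>C x))\<^sup>2 = (cmod c * norm x)\<^sup>2"
    by (metis of_real_eq_iff)
  then show ?thesis by (simp add: power2_eq_iff_nonneg)
qed

text \<open>Used twice: nonnegativity of the left side gives Cauchy-Schwarz, and the strict decrease
  for a nonzero inner product makes a nearest point an orthogonal projection.\<close>

lemma norm_sq_diff_projection:
  fixes x y :: "'a::complex_inner"
  assumes "y \<noteq> 0"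
  shows "(norm (x - (cinner x y / (norm y)\<^sup>2) *\<^sub>C y))\<^sup>2 = (norm x)\<^sup>2 - (cmod (cinner x y))\<^sup>2 / (norm y)\<^sup>2"
proof -
  define a where "a = cinner x y"
  have n: "norm y > 0" using assms by simp
  have "Re (cinner x ((a / (norm y)\<^sup>2) *\<^sub>C y)) = (cmod a)\<^sup>2 / (norm y)\<^sup>2"
    unfolding cinner_scaleC_right a_def[symmetric]
    by (simp add: cmod_def power2_eq_square field_simps)
  moreover have "(norm ((a / (norm y)\<^sup>2) *\<^sub>C y))\<^sup>2 = (cmod a)\<^sup>2 / (norm y)\<^sup>2"
    using n by (simp add: norm_scaleC norm_divide norm_mult power2_eq_square)
  ultimately show ?thesis
    unfolding norm_sq_diff a_def[symmetric] by simp
qed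

lemma cinner_cauchy_schwarz: "cmod (cinner x y) \<le> norm x * norm y" for x y :: "'a::complex_inner"
proof (cases "y = 0")
  case False
  then have "(cmod (cinner x y))\<^sup>2 / (norm y)\<^sup>2 \<le> (norm x)\<^sup>2"
    using norm_sq_diff_projection[OF False, of x] zero_le_power2 by (metis diff_ge_0_iff_ge)
  then have "(cmod (cinner x y))\<^sup>2 \<le> (norm x * norm y)\<^sup>2"
    using False by (simp add: field_simps)
  then show ?thesis
    by (rule power2_le_imp_le) simp
qed simp

lemma bounded_linear_cinner_left: "bounded_linear (\<lambda>x. cinner x y)" for y :: "'a::complex_inner"
  by (rule bounded_linear_intro[where K = "norm y"])
    (auto simp: cinner_add_left scaleR_scaleC cinner_scaleC_left cinner_cauchy_schwarz scaleR_conv_of_real)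

lemma cinner_eq_0_imp_eq:
  fixes x y :: "'a::complex_inner"
  assumes "\<And>z. cinner z x = cinner z y"
  shows "x = y"
  using assms[of "x - y"] cinner_diff_right[of "x - y" x y] cinner_eq_zero_iff[of "x - y"] by simp

section \<open>Nearest points, orthogonal projections and complements\<close>

lemma exists_nearest_point:
  fixes L :: "'a::chilbert_space set"
  assumes L: "complex_vector.subspace L" "closed L"
  shows "\<exists>u\<in>L. \<forall>y\<in>L. norm (x - u) \<le> norm (x - y)"
proof -
  define d where "d = infdist x L"
  have ne: "L \<noteq> {}" using L complex_vector.subspace_0 by blast
  have d0: "d \<ge> 0" by (simp add: d_def infdist_nonneg)
  have dle: "d \<le> norm (x - y)" if "y \<in> L" for y
    using infdist_le[OF that, of x] by (simp add: d_def dist_norm)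
  have "\<exists>y\<in>L. norm (x - y) < d + inverse (real (Suc n))" for n
  proof (rule ccontr)
    assume "\<not> ?thesis"
    then have "d + inverse (real (Suc n)) \<le> infdist x L"
      unfolding infdist_notempty[OF ne] 
      by (intro cINF_greatest ne) (auto simp: dist_norm not_less)
    then show False by (simp add: d_def)
  qed
  then obtain y where y: "\<And>n. y n \<in> L" "\<And>n. norm (x - y n) < d + inverse (real (Suc n))"
    by metis
  \<comment> \<open>Midpoints stay in L, hence at distance at least d from x, so the parallelogram
    law bounds the gap by 4(d + e)^2 - 4d^2 = 8de + 4e^2. This is at most (8d + 4)e because e \<le>
    1.\<close>
  have near: "(norm (y m - y n))\<^sup>2 \<le> (8 * d + 4) * inverse (real (Suc k))" if "m \<ge> k" "n \<ge> k" for m n k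
  proof -
    define e where "e = inverse (real (Suc k))"
    have e: "0 < e" "e \<le> 1" by (auto simp: e_def field_simps)
    have sq: "(norm (x - y j))\<^sup>2 \<le> (d + e)\<^sup>2" if "j \<ge> k" for j
    proof (rule power_mono)
      have "inverse (real (Suc j)) \<le> e" using that by (simp add: e_def field_simps)
      then show "norm (x - y j) \<le> d + e" using y(2)[of j] by simp
    qed simp
    have mid: "(1/2) *\<^sub>C (y m + y n) \<in> L"
      using L(1) y(1) by (simp add: complex_vector.subspace_add complex_vector.subspace_scale)
    have "(x - y m) + (x - y n) = 2 *\<^sub>C (x - (1/2) *\<^sub>C (y m + y n))"
    proof -
      have "2 *\<^sub>C (x - (1/2) *\<^sub>C (y m + y n)) = 2 *\<^sub>C x - (y m + y n)"
        by (simp add: complex_vector.scale_right_diff_distrib)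
      also have "2 *\<^sub>C x = x + x"
        using scaleC_add_left[of 1 1 x] by simp
      finally show ?thesis by simp
    qed
    then have "norm ((x - y m) + (x - y n)) = 2 * norm (x - (1/2) *\<^sub>C (y m + y n))"
      by (simp only: norm_scaleC) simp
    then have "2 * d \<le> norm ((x - y m) + (x - y n))"
      using dle[OF mid] by simp
    then have "(2 * d)\<^sup>2 \<le> (norm ((x - y m) + (x - y n)))\<^sup>2"
      using d0 by (intro power_mono) auto
    moreover have "(x - y m) - (x - y n) = y n - y m" by simp
    ultimately have "(norm (y m - y n))\<^sup>2 \<le> 4 * (d + e)\<^sup>2 - 4 * d\<^sup>2"
      using parallelogram_law[of "x - y m" "x - y n"] sq[OF that(1)] sq[OF that(2)]
      by (simp add: norm_minus_commute power_mult_distrib)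
    also have "\<dots> = 8 * d * e + 4 * (e * e)" by (simp add: power2_eq_square algebra_simps)
    also have "\<dots> \<le> 8 * d * e + 4 * e"
      using mult_left_le[OF e(2), of e] e by simp
    finally show ?thesis by (simp add: e_def algebra_simps)
  qed
  have "Cauchy y"
  proof (rule metric_CauchyI)
    fix \<epsilon> :: real assume \<epsilon>: "\<epsilon> > 0"
    define c where "c = \<epsilon>\<^sup>2 / (8 * d + 4)"
    have c: "c > 0" using \<epsilon> d0 by (simp add: c_def)
    obtain k where k: "inverse (real (Suc k)) < c"
      using reals_Archimedean[OF c] by auto
    have "dist (y m) (y n) < \<epsilon>" if "m \<ge> k" "n \<ge> k" for m n
    proof -
      have "(norm (y m - y n))\<^sup>2 \<le> (8 * d + 4) * inverse (real (Suc k))" by (rule near[OF that])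
      also have "\<dots> < (8 * d + 4) * c" using k d0 by (intro mult_strict_left_mono) auto
      also have "\<dots> = \<epsilon>\<^sup>2" using d0 by (simp add: c_def)
      finally show ?thesis using \<epsilon> by (simp add: dist_norm power2_less_imp_less)
    qed
    then show "\<exists>k. \<forall>m\<ge>k. \<forall>n\<ge>k. dist (y m) (y n) < \<epsilon>" by blast
  qed
  then obtain u where u: "y \<longlonglongrightarrow> u"
    using Cauchy_convergent convergent_def by blast
  have "u \<in> L" using closed_sequentially[OF L(2)] y(1) u by blast
  moreover have "norm (x - u) \<le> d"
  proof (rule LIMSEQ_le)
    show "(\<lambda>n. norm (x - y n)) \<longlonglongrightarrow> norm (x - u)" by (intro tendsto_intros u)
    show "(\<lambda>n. d + inverse (real (Suc n))) \<longlonglongrightarrow> d"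
      by (rule LIMSEQ_inverse_real_of_nat_add)
    show "\<exists>N. \<forall>n\<ge>N. norm (x - y n) \<le> d + inverse (real (Suc n))"
      using y(2) less_imp_le by blast
  qed
  ultimately show ?thesis using dle order_trans by blast
qed

lemma projection_theorem:
  fixes L :: "'a::chilbert_space set"
  assumes L: "complex_vector.subspace L" "closed L"
  shows "\<exists>u\<in>L. \<forall>y\<in>L. cinner (x - u) y = 0"
proof -
  obtain u where u: "u \<in> L" "\<And>y. y \<in> L \<Longrightarrow> norm (x - u) \<le> norm (x - y)"
    using exists_nearest_point[OF L] by blast
  have "cinner (x - u) y = 0" if "y \<in> L" for y
  proof (cases "y = 0")
    case False
    \<comment> \<open>Moving u by the component of x - u along y would come strictly closer to x
      unless that component vanishes.\<close>
    define c where "c = cinner (x - u) y / (norm y)\<^sup>2"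
    have "u + c *\<^sub>C y \<in> L"
      using L(1) u(1) that by (simp add: complex_vector.subspace_add complex_vector.subspace_scale)
    from u(2)[OF this] have "(norm (x - u))\<^sup>2 \<le> (norm (x - u - c *\<^sub>C y))\<^sup>2"
      by (simp add: diff_diff_eq)
    then have "(cmod (cinner (x - u) y))\<^sup>2 / (norm y)\<^sup>2 \<le> 0"
      unfolding c_def norm_sq_diff_projection[OF False] by simp
    then show ?thesis using False by (simp add: divide_le_0_iff)
  qed simp
  with u(1) show ?thesis by blast
qed

lemma orth_decomposition_complement:
  fixes L :: "'a::chilbert_space set"
  assumes L: "complex_vector.subspace L" "closed L"
  shows "orth_decomposition L {v. \<forall>u\<in>L. cinner u v = 0}" (is "orth_decomposition L ?M")
proof -
  have "complex_vector.subspace ?M"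
    by (auto simp: complex_vector.subspace_def cinner_simps)
  moreover have "closed ?M"
  proof -
    \<comment> \<open>The arguments are swapped to use continuity of the inner product in its first
      argument.\<close>
    have "?M = (\<Inter>u\<in>L. (\<lambda>v. cinner v u) -` {0})"
      by auto (metis cinner_commute complex_cnj_zero)+
    moreover have "closed ((\<lambda>v. cinner v u) -` {0})" for u :: 'a
      by (intro closed_vimage closed_singleton linear_continuous_on bounded_linear_cinner_left)
    ultimately show ?thesis by auto
  qed
  moreover have "\<exists>u\<in>L. \<exists>v\<in>?M. x = u + v" for x
  proof -
    obtain u where "u \<in> L" "\<forall>y\<in>L. cinner (x - u) y = 0"
      using projection_theorem[OF L] by blast
    moreover from this have "x - u \<in> ?M"
      by auto (metis cinner_commute complex_cnj_zero)
    ultimately show ?thesis by (intro bexI[of _ u] bexI[of _ "x - u"]) auto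
  qed
  ultimately show ?thesis
    using L unfolding orth_decomposition_def by blast
qed

section \<open>Bounded operators and adjoints\<close>

lemma bop_UNIV_linear:
  assumes "T \<in> bop UNIV UNIV"
  shows "T (x + y) = T x + T y" "T (x - y) = T x - T y" "T 0 = 0" "T (c *\<^sub>C x) = c *\<^sub>C T x"
proof -
  interpret bounded_linear T using assms bop_UNIV_iff by blast
  show "T (x + y) = T x + T y" "T (x - y) = T x - T y" "T 0 = 0"
    by (rule add diff zero)+
  show "T (c *\<^sub>C x) = c *\<^sub>C T x" using assms bop_UNIV_iff by blast
qed

lemma bop_UNIV_bound:
  assumes "T \<in> bop UNIV UNIV"
  obtains K where "K > 0" "\<And>x. norm (T x) \<le> K * norm x"
  using assms bop_UNIV_iff bounded_linear.pos_bounded by (metis mult.commute)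

lemma bop_comp:
  assumes "S \<in> bop UNIV UNIV" "T \<in> bop UNIV UNIV"
  shows "(\<lambda>x. S (T x)) \<in> bop UNIV UNIV"
  using assms by (auto simp: bop_UNIV_iff intro: bounded_linear_compose)

lemma bop_diff:
  assumes "S \<in> bop UNIV UNIV" "T \<in> bop UNIV UNIV"
  shows "(\<lambda>x. S x - T x) \<in> bop UNIV UNIV"
  using assms by (auto simp: bop_UNIV_iff complex_vector.scale_right_diff_distrib intro: bounded_linear_sub)

lemma bop_restrict:
  assumes "T \<in> bop UNIV UNIV" "T ` L \<subseteq> M"
  shows "T \<in> bop L M"
  using assms by (auto simp: bop_def)

section \<open>Riesz representation and adjoints\<close>

lemma riesz_representation:
  fixes f :: "'a::chilbert_space \<Rightarrow> complex"
  assumes f: "bounded_linear f" "\<And>c x. f (c *\<^sub>C x) = c * f x"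
  shows "\<exists>y. \<forall>x. f x = cinner x y"
proof (cases "\<forall>x. f x = 0")
  case True
  then show ?thesis by (intro exI[of _ 0]) simp
next
  case False
  then obtain x0 where x0: "f x0 \<noteq> 0" by blast
  interpret bounded_linear f by (rule f(1))
  let ?L = "f -` {0}"
  have "complex_vector.subspace ?L"
    by (auto simp: complex_vector.subspace_def add f(2) zero)
  moreover have "closed ?L"
    by (intro closed_vimage closed_singleton linear_continuous_on f(1))
  ultimately obtain u where u: "f u = 0" "\<And>y. f y = 0 \<Longrightarrow> cinner (x0 - u) y = 0"
    using projection_theorem[of ?L x0] by auto
  define z where "z = x0 - u"
  have fz: "f z \<noteq> 0" using x0 u by (simp add: z_def diff)
  then have z: "z \<noteq> 0" using zero by auto
  \<comment> \<open>The vector z is orthogonal to the kernel of f, and x differs from a multiple of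
    z by a kernel element. The coefficient is conjugated because the inner product is
    conjugate-linear in its second argument.\<close>
  have "f x = cinner x ((cnj (f z) / (norm z)\<^sup>2) *\<^sub>C z)" for x
  proof -
    have "f (x - (f x / f z) *\<^sub>C z) = 0" using fz by (simp add: diff f(2))
    then have "cinner (x - (f x / f z) *\<^sub>C z) z = 0"
      using u(2) z_def by (metis cinner_commute complex_cnj_zero)
    then have "cinner x z = f x / f z * (norm z)\<^sup>2"
      by (simp add: cinner_simps cinner_self)
    then show ?thesis using fz z by (simp add: cinner_scaleC_right)
  qed
  then show ?thesis by blast
qed

lemma adjoint_exists:
  fixes T :: "'a::chilbert_space \<Rightarrow> 'a"
  assumes T: "T \<in> bop UNIV UNIV"
  shows "\<exists>S. S \<in> bop UNIV UNIV \<and> (\<forall>x y. cinner (T x) y = cinner x (S y))"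
proof -
  have "\<exists>s. \<forall>x. cinner (T x) y = cinner x s" for y
  proof (rule riesz_representation)
    show "bounded_linear (\<lambda>x. cinner (T x) y)"
      using T bop_UNIV_iff bounded_linear_compose[OF bounded_linear_cinner_left] by blast
  qed (simp add: bop_UNIV_linear[OF T] cinner_scaleC_left)
  then obtain S where S: "\<And>x y. cinner (T x) y = cinner x (S y)" by metis
  obtain K where K: "K > 0" "\<And>x. norm (T x) \<le> K * norm x" using bop_UNIV_bound[OF T] by metis
  have "S (x + y) = S x + S y" for x y
    by (rule cinner_eq_0_imp_eq) (simp add: S[symmetric] cinner_add_right)
  moreover have "S (c *\<^sub>C x) = c *\<^sub>C S x" for c x
    by (rule cinner_eq_0_imp_eq) (simp add: S[symmetric] cinner_scaleC_right)
  moreover have "norm (S y) \<le> K * norm y" for y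
  proof (cases "S y = 0")
    case False
    \<comment> \<open>Testing the adjoint relation at x = S y lets one factor
      \<open>norm (S y)\<close> cancel, so S inherits the bound K of T.\<close>
    have "cmod (cinner (T (S y)) y) = norm (S y) * norm (S y)"
      by (simp add: S cinner_self norm_mult power2_eq_square)
    moreover have "cmod (cinner (T (S y)) y) \<le> K * norm (S y) * norm y"
      using cinner_cauchy_schwarz[of "T (S y)" y] mult_right_mono[OF K(2), of "norm y" "S y"] by simp
    ultimately show ?thesis using False by (simp add: mult_ac)
  qed (use K in simp)
  ultimately have "S \<in> bop UNIV UNIV" by (auto simp: bop_def)
  with S show ?thesis by blast
qed

lemma cadjoint_unique:
  assumes "S \<in> bop UNIV UNIV" "\<And>x y. cinner (T x) y = cinner x (S y)"
  shows "cadjoint T = S"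
  unfolding cadjoint_def
proof (rule the_equality)
  fix S' assume S': "S' \<in> bop UNIV UNIV \<and> (\<forall>x y. cinner (T x) y = cinner x (S' y))"
  show "S' = S"
  proof
    fix y show "S' y = S y"
      by (rule cinner_eq_0_imp_eq) (metis S' assms(2))
  qed
qed (use assms in auto)

lemma
  assumes "T \<in> bop UNIV UNIV"
  shows cadjoint_bop: "cadjoint T \<in> bop UNIV UNIV"
    and cinner_cadjoint_right: "cinner x (cadjoint T y) = cinner (T x) y"
proof -
  obtain S where S: "S \<in> bop UNIV UNIV" "\<And>x y. cinner (T x) y = cinner x (S y)"
    using adjoint_exists[OF assms] by blast
  then have "cadjoint T = S" by (rule cadjoint_unique)
  with S show "cadjoint T \<in> bop UNIV UNIV" "cinner x (cadjoint T y) = cinner (T x) y" by simp_all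
qed

lemma cinner_cadjoint_left:
  assumes "T \<in> bop UNIV UNIV"
  shows "cinner (cadjoint T x) y = cinner x (T y)"
  using cinner_cadjoint_right[OF assms, of y x] by (subst (1 2) cinner_commute) simp

lemma null_space_cadjoint:
  assumes "T \<in> bop UNIV UNIV"
  shows "null_space (cadjoint T) = {v. \<forall>u\<in>range T. cinner u v = 0}"
proof -
  have "cadjoint T v = 0" if "\<forall>x. cinner (T x) v = 0" for v
    using that cinner_cadjoint_right[OF assms, of "cadjoint T v" v] cinner_eq_zero_iff by metis
  then show ?thesis
    by (auto simp: null_space_def cinner_cadjoint_right[OF assms, symmetric])
qed

section \<open>Quasinilpotent operators\<close>

lemma quasinilpotent_on_iff:
  "quasinilpotent_on L T \<longleftrightarrow> (\<forall>z. z \<noteq> 0 \<longrightarrow> invertible_on L (\<lambda>x. z *\<^sub>C x - T x))"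
  by (auto simp: quasinilpotent_on_def spectrum_on_def)

lemma quasinilpotent_resolvent:
  assumes "quasinilpotent_on L Q"
  obtains R where "\<And>z. z \<noteq> 0 \<Longrightarrow> R z \<in> bop L L"
    "\<And>z x. z \<noteq> 0 \<Longrightarrow> x \<in> L \<Longrightarrow> R z (z *\<^sub>C x - Q x) = x"
    "\<And>z x. z \<noteq> 0 \<Longrightarrow> x \<in> L \<Longrightarrow> z *\<^sub>C R z x - Q (R z x) = x"
proof -
  have "\<forall>z. \<exists>S. z \<noteq> 0 \<longrightarrow> S \<in> bop L L \<and> (\<forall>x\<in>L. S (z *\<^sub>C x - Q x) = x \<and> z *\<^sub>C S x - Q (S x) = x)"
    using assms unfolding quasinilpotent_on_iff invertible_on_def by blast
  then obtain R where
    "\<forall>z. z \<noteq> 0 \<longrightarrow> R z \<in> bop L L \<and> (\<forall>x\<in>L. R z (z *\<^sub>C x - Q x) = x \<and> z *\<^sub>C R z x - Q (R z x) = x)"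
    by (rule choice[THEN exE])
  then show thesis by (intro that[of R]) auto
qed

text \<open>The adjoint of the resolvent at the conjugate point \<open>cnj z\<close> inverts z -
  Q*.\<close>

lemma quasinilpotent_cadjoint:
  assumes Q: "Q \<in> bop UNIV UNIV" and qn: "quasinilpotent_on UNIV Q"
  shows "quasinilpotent_on UNIV (cadjoint Q)"
  unfolding quasinilpotent_on_iff
proof (intro allI impI)
  fix z :: complex assume "z \<noteq> 0"
  obtain R where R: "\<And>z. z \<noteq> 0 \<Longrightarrow> R z \<in> bop UNIV UNIV"
    "\<And>z x. z \<noteq> 0 \<Longrightarrow> R z (z *\<^sub>C x - Q x) = x"
    "\<And>z x. z \<noteq> 0 \<Longrightarrow> z *\<^sub>C R z x - Q (R z x) = x"
    by (rule quasinilpotent_resolvent[OF qn]) auto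
  define w where "w = cnj z"
  have w: "w \<noteq> 0" "cnj w = z" using \<open>z \<noteq> 0\<close> by (auto simp: w_def)
  note lin = bop_UNIV_linear[OF R(1)[OF w(1)]]
  have "cadjoint (R w) (z *\<^sub>C x - cadjoint Q x) = x" for x
  proof (rule cinner_eq_0_imp_eq)
    fix v
    have "cinner v (cadjoint (R w) (z *\<^sub>C x - cadjoint Q x)) = cinner (w *\<^sub>C R w v - Q (R w v)) x"
      using w by (simp add: cinner_cadjoint_right Q R(1) cinner_simps) (simp add: w_def)
    then show "cinner v (cadjoint (R w) (z *\<^sub>C x - cadjoint Q x)) = cinner v x"
      by (simp add: R(3) w(1))
  qed
  moreover have "z *\<^sub>C cadjoint (R w) x - cadjoint Q (cadjoint (R w) x) = x" for x
  proof (rule cinner_eq_0_imp_eq)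
    fix v
    have "cinner v (z *\<^sub>C cadjoint (R w) x - cadjoint Q (cadjoint (R w) x))
        = cinner (R w (w *\<^sub>C v - Q v)) x"
      using w by (simp add: cinner_cadjoint_right Q R(1) cinner_simps lin) (simp add: w_def)
    then show "cinner v (z *\<^sub>C cadjoint (R w) x - cadjoint Q (cadjoint (R w) x)) = cinner v x"
      by (simp add: R(2) w(1))
  qed
  ultimately show "invertible_on UNIV (\<lambda>x. z *\<^sub>C x - cadjoint Q x)"
    unfolding invertible_on_def using cadjoint_bop[OF R(1)[OF w(1)]] by blast
qed

text \<open>Under the hypotheses \<open>z \<mapsto> \<phi> ((z - Q)\<^sup>-\<^sup>1 x)\<close> is holomorphic off 0, bounded near 0 and vanishes at
  infinity, hence zero by Liouville's theorem; \<open>\<phi> x\<close> is its leading coefficient at infinity.\<close>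

lemma quasinilpotent_functional_eq_0:
  fixes Q :: "'a::chilbert_space \<Rightarrow> 'a" and \<phi> :: "'a \<Rightarrow> complex"
  assumes Q: "Q \<in> bop UNIV UNIV" and qn: "quasinilpotent_on UNIV Q"
    and \<phi>: "bounded_linear \<phi>" "\<And>c v. \<phi> (c *\<^sub>C v) = c * \<phi> v"
    and r: "r > 0"
    and bd: "\<And>z v. z \<noteq> 0 \<Longrightarrow> cmod z < r \<Longrightarrow> z *\<^sub>C v - Q v = x \<Longrightarrow> cmod (\<phi> v) \<le> B"
  shows "\<phi> x = 0"
proof -
  interpret \<phi>: bounded_linear \<phi> by (rule \<phi>(1))
  obtain R where R: "\<And>z. z \<noteq> 0 \<Longrightarrow> R z \<in> bop UNIV UNIV"
    "\<And>z x. z \<noteq> 0 \<Longrightarrow> R z (z *\<^sub>C x - Q x) = x"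
    "\<And>z x. z \<noteq> 0 \<Longrightarrow> z *\<^sub>C R z x - Q (R z x) = x"
    by (rule quasinilpotent_resolvent[OF qn]) auto
  \<comment> \<open>The resolvent identity: z - Q sends \<open>R w x - R z x\<close> to
    \<open>(z - w) *\<^sub>C R w x\<close>, and \<open>R z\<close> undoes z - Q.\<close>
  have resolvent_eq: "R w x - R z x = (z - w) *\<^sub>C R z (R w x)" if "z \<noteq> 0" "w \<noteq> 0" for z w
  proof -
    have "z *\<^sub>C R w x - Q (R w x) = (z - w) *\<^sub>C R w x + (w *\<^sub>C R w x - Q (R w x))"
      by (simp add: complex_vector.scale_left_diff_distrib)
    then have "z *\<^sub>C (R w x - R z x) - Q (R w x - R z x)
        = (z - w) *\<^sub>C R w x + (w *\<^sub>C R w x - Q (R w x)) - (z *\<^sub>C R z x - Q (R z x))"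
      by (simp add: complex_vector.scale_right_diff_distrib bop_UNIV_linear[OF Q])
    also have "\<dots> = (z - w) *\<^sub>C R w x"
      using R(3) that by simp
    finally show ?thesis
      using R(2)[OF that(1), of "R w x - R z x"] bop_UNIV_linear(4)[OF R(1)[OF that(1)]] by simp
  qed
  have cont: "((\<lambda>w. R w x) \<longlongrightarrow> R z x) (at z)" if z: "z \<noteq> 0" for z
  proof -
    obtain K where K: "K > 0" "\<And>y. norm (R z y) \<le> K * norm y"
      using bop_UNIV_bound[OF R(1)[OF z]] by metis
    \<comment> \<open>The resolvent identity leaves \<open>R w x\<close> on the right. Within
      distance 1/(2K) half of its norm can be absorbed, so no local bound on the resolvent is needed
      beforehand.\<close>
    have est: "norm (R w x - R z x) \<le> norm (z - w) * (K * (2 * norm (R z x)))"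
      if w: "w \<noteq> 0" "dist w z < 1 / (2 * K)" for w
    proof -
      have "norm (R w x - R z x) = norm (z - w) * norm (R z (R w x))"
        using resolvent_eq[OF z w(1)] by (simp add: norm_scaleC)
      also have "\<dots> \<le> norm (z - w) * (K * norm (R w x))"
        by (intro mult_left_mono K) simp
      finally have 1: "norm (R w x - R z x) \<le> norm (z - w) * (K * norm (R w x))" .
      have "norm (z - w) * K \<le> 1 / 2"
        using w(2) K(1) by (simp add: dist_norm norm_minus_commute field_simps)
      from mult_right_mono[OF this, of "norm (R w x)"] 1
      have "norm (R w x - R z x) \<le> 1 / 2 * norm (R w x)" by (simp add: mult.assoc)
      then have "norm (R w x) \<le> 2 * norm (R z x)"
        using norm_triangle_sub[of "R w x" "R z x"] by simp
      then have "norm (z - w) * (K * norm (R w x)) \<le> norm (z - w) * (K * (2 * norm (R z x)))"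
        using K(1) by (intro mult_left_mono) auto
      with 1 show ?thesis by simp
    qed
    have "((\<lambda>w. R w x - R z x) \<longlongrightarrow> 0) (at z)"
    proof (rule Lim_null_comparison)
      have "eventually (\<lambda>w. dist w z < 1 / (2 * K)) (at z)"
        unfolding eventually_at using K(1) by (intro exI[of _ "1 / (2 * K)"]) auto
      moreover have "eventually (\<lambda>w. w \<noteq> 0) (at z)"
        using eventually_neq_at_within by blast
      ultimately show "eventually (\<lambda>w. norm (R w x - R z x)
          \<le> norm (z - w) * (K * (2 * norm (R z x)))) (at z)"
        by eventually_elim (rule est)
      show "((\<lambda>w. norm (z - w) * (K * (2 * norm (R z x)))) \<longlongrightarrow> 0) (at z)"
        by (rule tendsto_eq_intros refl | simp)+
    qed
    then show ?thesis by (rule LIM_zero_cancel)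
  qed
  define f where "f = (\<lambda>z. \<phi> (R z x))"
  \<comment> \<open>By the resolvent identity the difference quotient is
    \<open>- \<phi> (R z (R w x))\<close>, so continuity of \<open>w \<mapsto> R w x\<close> already
    gives differentiability.\<close>
  have "(f has_field_derivative - \<phi> (R z (R z x))) (at z)" if z: "z \<noteq> 0" for z
    unfolding has_field_derivative_iff
  proof (rule Lim_transform_eventually)
    have "bounded_linear (R z)" using R(1)[OF z] bop_UNIV_iff by blast
    from bounded_linear.tendsto[OF this cont[OF z]]
    show "((\<lambda>w. - \<phi> (R z (R w x))) \<longlongrightarrow> - \<phi> (R z (R z x))) (at z)"
      by (intro tendsto_minus \<phi>.tendsto)
    have "eventually (\<lambda>w. w \<noteq> 0 \<and> w \<noteq> z) (at z)"
      using eventually_neq_at_within by (intro eventually_conj) auto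
    then show "eventually (\<lambda>w. - \<phi> (R z (R w x)) = (f w - f z) / (w - z)) (at z)"
    proof eventually_elim
      case (elim w)
      have "f w - f z = (z - w) * \<phi> (R z (R w x))"
        using resolvent_eq[OF z, of w] elim by (simp add: f_def \<phi>.diff[symmetric] \<phi>(2))
      with elim show ?case by (simp add: field_simps)
    qed
  qed
  then have "f holomorphic_on UNIV - {0}"
    by (auto simp: holomorphic_on_open open_Diff)
  \<comment> \<open>The hypothesis \<open>bd\<close> applies to v = \<open>R z x\<close>; a bounded
    isolated singularity is removable.\<close>
  moreover have "eventually (\<lambda>z. cmod (f z) \<le> B) (at 0)"
    unfolding eventually_at f_def using r bd R(3) by (intro exI[of _ r]) auto
  ultimately obtain g where g: "g holomorphic_on UNIV" "\<And>z. z \<noteq> 0 \<Longrightarrow> g z = f z"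
    using holomorphic_on_extend_bounded[of f UNIV 0] by auto
  obtain K where K: "K > 0" "\<And>y. norm (Q y) \<le> K * norm y"
    using bop_UNIV_bound[OF Q] by metis
  have nz: "eventually (\<lambda>z::complex. z \<noteq> 0) at_infinity"
    unfolding eventually_at_infinity by (intro exI[of _ 1]) auto
  have R0: "((\<lambda>z. R z x) \<longlongrightarrow> 0) at_infinity"
  proof (rule Lim_null_comparison)
    \<comment> \<open>From \<open>z *\<^sub>C R z x = x + Q (R z x)\<close>: for |z| \<ge> 2K the
      last term is at most half of the left side in norm.\<close>
    have est: "norm (R z x) \<le> norm (inverse z) * (2 * norm x)" if z: "norm z \<ge> 2 * K" for z
    proof -
      have z0: "z \<noteq> 0" using z K(1) by auto
      have "norm (z *\<^sub>C R z x) \<le> norm x + norm (Q (R z x))"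
        using R(3)[OF z0, of x] norm_triangle_sub[of "z *\<^sub>C R z x" "Q (R z x)"] by simp
      then have "norm z * norm (R z x) \<le> norm x + K * norm (R z x)"
        using K(2)[of "R z x"] by (simp add: norm_scaleC)
      moreover have "2 * K * norm (R z x) \<le> norm z * norm (R z x)"
        using z by (rule mult_right_mono) simp
      ultimately have "norm z * norm (R z x) \<le> 2 * norm x" by simp
      then show ?thesis using z0 by (simp add: norm_divide field_simps)
    qed
    then show "eventually (\<lambda>z. norm (R z x) \<le> norm (inverse z) * (2 * norm x)) at_infinity"
      unfolding eventually_at_infinity by blast
    show "((\<lambda>z::complex. norm (inverse z) * (2 * norm x)) \<longlongrightarrow> 0) at_infinity"
      by (intro tendsto_mult_left_zero tendsto_norm_zero tendsto_inverse_0)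
  qed
  have "(f \<longlongrightarrow> 0) at_infinity"
    unfolding f_def by (rule \<phi>.tendsto_zero[OF R0])
  then have "(g \<longlongrightarrow> 0) at_infinity"
    by (rule Lim_transform_eventually) (use nz in eventually_elim, simp add: g(2))
  then have f0: "f z = 0" if "z \<noteq> 0" for z
    using Liouville_weak[OF g(1)] g(2)[OF that] by metis
  have "bounded_linear Q" using Q bop_UNIV_iff by blast
  then have "((\<lambda>z. - \<phi> (Q (R z x))) \<longlongrightarrow> 0) at_infinity"
    using tendsto_minus[OF \<phi>.tendsto_zero[OF bounded_linear.tendsto_zero[OF _ R0]]] by simp
  \<comment> \<open>Once f vanishes, only the Q-term of the resolvent equation survives, and it
    tends to 0 at infinity.\<close>
  moreover have "eventually (\<lambda>z. - \<phi> (Q (R z x)) = \<phi> x) at_infinity"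
    using nz
  proof eventually_elim
    case (elim z)
    have "\<phi> x = z * \<phi> (R z x) - \<phi> (Q (R z x))"
      using R(3)[OF elim, of x] by (metis \<phi>.diff \<phi>(2))
    then show ?case using f0[OF elim] by (simp add: f_def)
  qed
  ultimately have "((\<lambda>z::complex. \<phi> x) \<longlongrightarrow> 0) at_infinity"
    by (rule Lim_transform_eventually)
  then show ?thesis
    using tendsto_unique[OF trivial_limit_at_infinity _ tendsto_const] by metis
qed

section \<open>Uniqueness of the generalized Drazin inverse\<close>

text \<open>The equations are oriented for rewriting: A moves inward past D, and then DDA, a form of
  DAD, contracts to D.\<close>

lemma is_gdrazin_inverseD:
  assumes "is_gdrazin_inverse A D"
  shows "D \<in> bop UNIV UNIV" "A (D x) = D (A x)" "D (D (A x)) = D x"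
    "quasinilpotent_on UNIV (\<lambda>x. A x - A (A (D x)))"
proof -
  have *: "A (D x) = D (A x)" "D (A (D x)) = D x" for x
    using assms unfolding is_gdrazin_inverse_def fun_eq_iff by auto
  from * show "A (D x) = D (A x)" "D (D (A x)) = D x" by auto
  show "D \<in> bop UNIV UNIV" "quasinilpotent_on UNIV (\<lambda>x. A x - A (A (D x)))"
    using assms unfolding is_gdrazin_inverse_def by (auto simp: numeral_2_eq_2)
qed

lemma is_gdrazin_inverseI:
  assumes "D \<in> bop UNIV UNIV" "\<And>x. A (D x) = D (A x)" "\<And>x. D (D (A x)) = D x"
    "quasinilpotent_on UNIV (\<lambda>x. A x - A (A (D x)))"
  shows "is_gdrazin_inverse A D"
  using assms unfolding is_gdrazin_inverse_def by (auto simp: numeral_2_eq_2 fun_eq_iff)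

text \<open>For \<open>x\<close> in the kernel of \<open>AD'\<close> and \<open>v = (z - A(I - AD'))\<^sup>-\<^sup>1 x\<close> one has
  \<open>(I - zD)(DAv) = -Dx\<close>, so \<open>DAv\<close> stays bounded as \<open>z \<rightarrow> 0\<close>.\<close>

lemma gdrazin_projection_absorb:
  fixes A :: "'a::chilbert_space \<Rightarrow> 'a"
  assumes A: "A \<in> bop UNIV UNIV" and D: "is_gdrazin_inverse A D" and D': "is_gdrazin_inverse A D'"
  shows "D (A (D' (A x))) = D (A x)"
proof -
  note d = is_gdrazin_inverseD[OF D] and d' = is_gdrazin_inverseD[OF D']
  note lin = bop_UNIV_linear[OF A] bop_UNIV_linear[OF d(1)] bop_UNIV_linear[OF d'(1)]
  define Q where "Q = (\<lambda>x. A x - A (A (D' x)))"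
  \<comment> \<open>Since D'A is idempotent, x' lies in its kernel; the claim amounts to DAx' =
    0.\<close>
  define x' where "x' = x - D' (A x)"
  have Q: "Q \<in> bop UNIV UNIV"
    unfolding Q_def by (intro bop_diff A bop_comp[OF A bop_comp[OF A d'(1)]])
  obtain K where K: "K > 0" "\<And>y. norm (D y) \<le> K * norm y" using bop_UNIV_bound[OF d(1)] by metis
  have bdd: "norm (D (A v)) \<le> 2 * norm (D x')"
    if z: "z \<noteq> 0" "cmod z < 1 / (2 * K)" and v: "z *\<^sub>C v - Q v = x'" for z v
  proof -
    \<comment> \<open>D'A annihilates both Q v and x', so the equation for v reduces to z D'Av = 0.
      Hence v lies in the kernel too, where Q agrees with A.\<close>
    have "D' (A (Q v)) = 0" by (simp add: Q_def lin d'(2,3))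
    moreover have "D' (A x') = 0" by (simp add: x'_def lin d'(2,3))
    ultimately have "z *\<^sub>C D' (A v) = 0"
      using arg_cong[OF v, of "\<lambda>y. D' (A y)"] by (simp add: lin)
    then have "D' (A v) = 0" using z(1) by simp
    then have "A (D' (A v)) = 0" by (simp add: lin)
    then have "Q v = A v" by (simp add: Q_def d'(2))
    then have "z *\<^sub>C D v - D (A v) = D x'"
      using arg_cong[OF v, of D] by (simp add: lin)
    moreover have "D v = D (D (A v))" by (simp add: d(3))
    ultimately have "D (A v) = z *\<^sub>C D (D (A v)) - D x'" by (simp add: algebra_simps)
    then have "norm (D (A v)) \<le> cmod z * norm (D (D (A v))) + norm (D x')"
      by (metis norm_scaleC norm_triangle_ineq4)
    also have "\<dots> \<le> cmod z * (K * norm (D (A v))) + norm (D x')"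
      by (intro add_right_mono mult_left_mono K) simp
    \<comment> \<open>The radius 1/(2K) makes zD a contraction by 1/2, so this term is absorbed on
      the left.\<close>
    also have "cmod z * (K * norm (D (A v))) \<le> 1 / 2 * norm (D (A v))"
      using mult_right_mono[of "cmod z * K" "1 / 2" "norm (D (A v))"] z(2) K(1)
      by (simp add: field_simps)
    finally show ?thesis by simp
  qed
  have "cinner (D (A x')) y = 0" for y
  proof (rule quasinilpotent_functional_eq_0[OF Q, where r = "1 / (2 * K)" and x = x'
        and \<phi> = "\<lambda>v. cinner (D (A v)) y" and B = "2 * norm (D x') * norm y"])
    show "quasinilpotent_on UNIV Q" unfolding Q_def by (rule d'(4))
    show "bounded_linear (\<lambda>v. cinner (D (A v)) y)"
      using bounded_linear_compose[OF bounded_linear_cinner_left] bop_comp[OF d(1) A] bop_UNIV_iff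
      by blast
    show "cmod (cinner (D (A v)) y) \<le> 2 * norm (D x') * norm y"
      if "z \<noteq> 0" "cmod z < 1 / (2 * K)" "z *\<^sub>C v - Q v = x'" for z v
      using cinner_cauchy_schwarz[of "D (A v)" y] mult_right_mono[OF bdd[OF that], of "norm y"]
      by simp
  qed (use K in \<open>simp_all add: lin cinner_scaleC_left\<close>)
  then have "D (A x') = 0" using cinner_eq_zero_iff by blast
  then show ?thesis by (simp add: x'_def lin)
qed

lemma is_gdrazin_inverse_cadjoint:
  fixes A :: "'a::chilbert_space \<Rightarrow> 'a"
  assumes A: "A \<in> bop UNIV UNIV" and D: "is_gdrazin_inverse A D"
  shows "is_gdrazin_inverse (cadjoint A) (cadjoint D)"
proof (rule is_gdrazin_inverseI)
  note d = is_gdrazin_inverseD[OF D]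
  note adj = cadjoint_bop[OF A] cadjoint_bop[OF d(1)]
  note right = cinner_cadjoint_right[OF A] cinner_cadjoint_right[OF d(1)]
  show "cadjoint D \<in> bop UNIV UNIV" by (rule adj)
  show "cadjoint A (cadjoint D x) = cadjoint D (cadjoint A x)" for x
    by (rule cinner_eq_0_imp_eq) (simp add: right d)
  show "cadjoint D (cadjoint D (cadjoint A x)) = cadjoint D x" for x
    by (rule cinner_eq_0_imp_eq) (simp add: right d)
  have Q: "(\<lambda>x. A x - A (A (D x))) \<in> bop UNIV UNIV"
    by (intro bop_diff A bop_comp[OF A bop_comp[OF A d(1)]])
  \<comment> \<open>Taking adjoints reverses the product AAD; commutation of A and D restores the
    order.\<close>
  have "cadjoint (\<lambda>x. A x - A (A (D x))) = (\<lambda>x. cadjoint A x - cadjoint A (cadjoint A (cadjoint D x)))"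
    by (rule cadjoint_unique[OF bop_diff[OF adj(1) bop_comp[OF adj(1) bop_comp[OF adj]]]])
      (simp add: cinner_simps right d(2))
  then show "quasinilpotent_on UNIV (\<lambda>x. cadjoint A x - cadjoint A (cadjoint A (cadjoint D x)))"
    using quasinilpotent_cadjoint[OF Q d(4)] by simp
qed

lemma gdrazin_unique:
  fixes A :: "'a::chilbert_space \<Rightarrow> 'a"
  assumes A: "A \<in> bop UNIV UNIV" and D: "is_gdrazin_inverse A D" and D': "is_gdrazin_inverse A D'"
  shows "D = D'"
proof
  note d = is_gdrazin_inverseD[OF D] and d' = is_gdrazin_inverseD[OF D']
  have 1: "D' (A (D (A x))) = D' (A x)" for x
    by (rule gdrazin_projection_absorb[OF A D' D])
  \<comment> \<open>Adjoints reverse the product in the absorption law, so the composite of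
    \<open>1\<close> now collapses to its other factor.\<close>
  have 2: "D' (A (D (A x))) = D (A x)" for x
  proof (rule cinner_eq_0_imp_eq)
    fix y
    note adj_D = is_gdrazin_inverse_cadjoint[OF A D] and adj_D' = is_gdrazin_inverse_cadjoint[OF A D']
    note left = cinner_cadjoint_left[OF A, symmetric] cinner_cadjoint_left[OF d(1), symmetric]
      cinner_cadjoint_left[OF d'(1), symmetric]
    show "cinner y (D' (A (D (A x)))) = cinner y (D (A x))"
      using gdrazin_projection_absorb[OF cadjoint_bop[OF A] adj_D adj_D', of y]
      by (simp add: left is_gdrazin_inverseD(2)[OF adj_D] is_gdrazin_inverseD(2)[OF adj_D'])
  qed
  have 3: "D (A y) = D' (A y)" for y using 1 2 by simp
  fix x
  have "D x = D (A (D x))" by (simp add: d(2,3))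
  also have "\<dots> = D' (A (D x))" by (rule 3)
  also have "\<dots> = D' (D' (A x))" by (simp add: d(2) 3)
  finally show "D x = D' x" by (simp add: d'(3))
qed

lemma is_gdrazin_inverse_gdrazin:
  fixes A :: "'a::chilbert_space \<Rightarrow> 'a"
  assumes "A \<in> bop UNIV UNIV" "gdrazin_invertible A"
  shows "is_gdrazin_inverse A (gdrazin A)"
  using assms gdrazin_unique unfolding gdrazin_def gdrazin_invertible_def by (metis theI)

section \<open>Orthogonal decompositions\<close>

lemma orth_decomposition_sym:
  assumes "orth_decomposition L M"
  shows "orth_decomposition M L"
  using assms unfolding orth_decomposition_def
  by (metis add.commute cinner_commute complex_cnj_zero)

lemma orth_proj_eq:
  assumes "orth_decomposition L M" "u \<in> L" "v \<in> M"
  shows "orth_proj L (u + v) = u"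
  unfolding orth_proj_def
proof (rule the_equality)
  have orth: "cinner v y = 0" if "y \<in> L" for y
    using assms orth_decomposition_sym[OF assms(1)] that unfolding orth_decomposition_def by blast
  then show "u \<in> L \<and> (\<forall>y\<in>L. cinner (u + v - u) y = 0)" using assms(2) by simp
  fix w assume w: "w \<in> L \<and> (\<forall>y\<in>L. cinner (u + v - w) y = 0)"
  have L: "complex_vector.subspace L" using assms(1) orth_decomposition_def by blast
  then have "u - w \<in> L" using w assms(2) complex_vector.subspace_diff by blast
  then have "cinner (u + v - w) (u - w) = 0" "cinner v (u - w) = 0" using w orth by auto
  moreover have "u + v - w = (u - w) + v" by simp
  ultimately have "cinner (u - w) (u - w) = 0" by (simp add: cinner_add_left)
  then show "w = u" by (simp add: cinner_eq_zero_iff)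
qed

lemma orth_proj_simps:
  assumes dec: "orth_decomposition L M"
  shows "orth_proj L x \<in> L"
    and "orth_proj M x \<in> M"
    and "orth_proj L x + orth_proj M x = x"
    and "u \<in> L \<Longrightarrow> orth_proj L u = u"
    and "v \<in> M \<Longrightarrow> orth_proj L v = 0"
proof -
  note dec' = orth_decomposition_sym[OF dec]
  obtain u v where uv: "u \<in> L" "v \<in> M" "x = u + v"
    using dec unfolding orth_decomposition_def by blast
  then have "orth_proj L x = u" "orth_proj M x = v"
    using orth_proj_eq[OF dec uv(1,2)] orth_proj_eq[OF dec' uv(2,1)] by (simp_all add: add.commute)
  with uv show "orth_proj L x \<in> L" "orth_proj M x \<in> M" "orth_proj L x + orth_proj M x = x" by auto
  have "0 \<in> L" "0 \<in> M"
    using dec complex_vector.subspace_0 unfolding orth_decomposition_def by blast+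
  then show "u \<in> L \<Longrightarrow> orth_proj L u = u" "v \<in> M \<Longrightarrow> orth_proj L v = 0" for u v
    using orth_proj_eq[OF dec, of u 0] orth_proj_eq[OF dec, of 0 v] by simp_all
qed

lemma orth_proj_bop:
  assumes dec: "orth_decomposition L M"
  shows "orth_proj L \<in> bop UNIV UNIV"
proof -
  note p = orth_proj_simps[OF dec]
  have sub: "complex_vector.subspace L" "complex_vector.subspace M"
    and orth: "\<And>u v. u \<in> L \<Longrightarrow> v \<in> M \<Longrightarrow> cinner u v = 0"
    using dec unfolding orth_decomposition_def by blast+
  have "orth_proj L (x + y) = orth_proj L x + orth_proj L y" for x y
  proof -
    have "x + y = (orth_proj L x + orth_proj L y) + (orth_proj M x + orth_proj M y)"
      using p(3)[of x] p(3)[of y] by (metis add.assoc add.left_commute)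
    then show ?thesis
      using orth_proj_eq[OF dec] sub p(1,2) complex_vector.subspace_add by metis
  qed
  moreover have "orth_proj L (c *\<^sub>C x) = c *\<^sub>C orth_proj L x" for c x
  proof -
    have "c *\<^sub>C x = c *\<^sub>C orth_proj L x + c *\<^sub>C orth_proj M x"
      using p(3)[of x] by (metis scaleC_add_right)
    then show ?thesis
      using orth_proj_eq[OF dec] sub p(1,2) complex_vector.subspace_scale by metis
  qed
  moreover have "norm (orth_proj L x) \<le> 1 * norm x" for x
  proof -
    have "(norm (orth_proj L x))\<^sup>2 \<le> (norm (orth_proj L x + orth_proj M x))\<^sup>2"
      using orth[OF p(1) p(2), of x x] by (simp add: norm_sq_add)
    then show ?thesis by (simp add: p(3))
  qed
  ultimately show ?thesis unfolding bop_def by blast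
qed

section \<open>The core-EP decomposition\<close>

lemma orth_decomposition_range_gdrazin:
  fixes A :: "'a::chilbert_space \<Rightarrow> 'a"
  assumes A: "A \<in> bop UNIV UNIV" and D: "is_gdrazin_inverse A D"
  shows "orth_decomposition (range D) (null_space (cadjoint D))"
proof -
  note d = is_gdrazin_inverseD[OF D]
  note lin = bop_UNIV_linear[OF A] bop_UNIV_linear[OF d(1)]
  \<comment> \<open>The range of D is the fixed space of the idempotent DA, that is, the kernel of a
    bounded operator; this makes it closed.\<close>
  have eq: "range D = (\<lambda>x. x - D (A x)) -` {0}"
  proof (intro equalityI subsetI)
    fix x assume "x \<in> (\<lambda>x. x - D (A x)) -` {0}"
    then have "x = D (A x)" by simp
    then show "x \<in> range D" by blast
  qed (auto simp: d(2,3))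
  have "(\<lambda>x. x) \<in> bop UNIV (UNIV :: 'a set)"
    unfolding bop_UNIV_iff by (auto intro: bounded_linear_ident)
  then have "(\<lambda>x. x - D (A x)) \<in> bop UNIV UNIV"
    by (rule bop_diff[OF _ bop_comp[OF d(1) A]])
  then have "closed (range D)"
    unfolding eq bop_UNIV_iff
    by (intro closed_vimage closed_singleton linear_continuous_on) auto
  moreover have "complex_vector.subspace (range D)"
    unfolding eq complex_vector.subspace_def by (auto simp: lin)
  ultimately show ?thesis
    unfolding null_space_cadjoint[OF d(1)] by (intro orth_decomposition_complement)
qed

text \<open>\<open>P\<^sub>M (z - A(I - AD))\<^sup>-\<^sup>1\<close> inverts the compression \<open>z - P\<^sub>M A\<close> on \<open>M\<close>, because
  \<open>P\<^sub>M A = P\<^sub>M A(I - AD)\<close> and \<open>A(I - AD)\<close> vanishes on \<open>L = R(D)\<close>.\<close>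

lemma quasinilpotent_compression:
  fixes A :: "'a::chilbert_space \<Rightarrow> 'a"
  assumes A: "A \<in> bop UNIV UNIV" and D: "is_gdrazin_inverse A D"
    and dec: "orth_decomposition (range D) M"
  shows "quasinilpotent_on M (\<lambda>x. orth_proj M (A x))"
  unfolding quasinilpotent_on_iff
proof (intro allI impI)
  fix z :: complex assume z: "z \<noteq> 0"
  note d = is_gdrazin_inverseD[OF D]
  note dec' = orth_decomposition_sym[OF dec]
  let ?P = "orth_proj M" and ?L = "orth_proj (range D)"
  define Q where "Q = (\<lambda>x. A x - A (A (D x)))"
  note p = orth_proj_simps[OF dec] and p' = orth_proj_simps[OF dec']
  note P = orth_proj_bop[OF dec']
  note lin = bop_UNIV_linear[OF P] bop_UNIV_linear[OF A] bop_UNIV_linear[OF d(1)]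
  obtain R where R: "\<And>z. z \<noteq> 0 \<Longrightarrow> R z \<in> bop UNIV UNIV"
    "\<And>z x. z \<noteq> 0 \<Longrightarrow> R z (z *\<^sub>C x - Q x) = x"
    "\<And>z x. z \<noteq> 0 \<Longrightarrow> z *\<^sub>C R z x - Q (R z x) = x"
    by (rule quasinilpotent_resolvent[OF d(4)[folded Q_def]]) auto
  note linR = bop_UNIV_linear[OF R(1)[OF z]]
  have Qrange: "Q u = 0" if "u \<in> range D" for u
    using that by (auto simp: Q_def d(2,3))
  have Qbop: "Q \<in> bop UNIV UNIV"
    unfolding Q_def by (intro bop_diff A bop_comp[OF A bop_comp[OF A d(1)]])
  \<comment> \<open>AADx = DAAx lies in the range of D, which the projection onto M kills.\<close>
  have PA: "?P (A x) = ?P (Q x)" for x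
  proof -
    have "A (A (D x)) = D (A (A x))" by (simp add: d(2))
    then show ?thesis by (simp add: Q_def lin p'(5))
  qed
  have QP: "Q (?P x) = Q x" for x
    using bop_UNIV_linear(1)[OF Qbop, of "?L x" "?P x"] p(3)[of x] Qrange[OF p(1)] by simp
  \<comment> \<open>Q vanishes on the range of D, so the resolvent acts there as multiplication by
    1/z.\<close>
  have Rrange: "R z u \<in> range D" if "u \<in> range D" for u
  proof -
    have "R z (z *\<^sub>C u - Q u) = z *\<^sub>C R z u" using Qrange[OF that] by (simp add: linR)
    then have "u = z *\<^sub>C R z u" using R(2)[OF z, of u] by simp
    then have "inverse z *\<^sub>C u = inverse z *\<^sub>C (z *\<^sub>C R z u)" by simp
    then have "R z u = inverse z *\<^sub>C u" using z by simp
    then show ?thesis using dec that complex_vector.subspace_scale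
      unfolding orth_decomposition_def by metis
  qed
  show "invertible_on M (\<lambda>x. z *\<^sub>C x - ?P (A x))"
    unfolding invertible_on_def
  proof (intro bexI[of _ "\<lambda>x. ?P (R z x)"] ballI conjI)
    show "(\<lambda>x. ?P (R z x)) \<in> bop M M"
      using bop_comp[OF P R(1)[OF z]] by (rule bop_restrict) (auto simp: p(2))
    fix m assume m: "m \<in> M"
    have "z *\<^sub>C ?P (R z m) - ?P (A (?P (R z m))) = ?P (z *\<^sub>C R z m - Q (R z m))"
      by (simp add: PA QP lin)
    then show "z *\<^sub>C ?P (R z m) - ?P (A (?P (R z m))) = m"
      using R(3)[OF z] p'(4)[OF m] by simp
    \<comment> \<open>Replacing the compression by z - Q costs an error in the range of D; the
      resolvent keeps it there and the final projection removes it.\<close>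
    have "?P (Q m) = Q m - ?L (Q m)" using p(3)[of "Q m"] by (simp add: eq_diff_eq add.commute)
    then have "z *\<^sub>C m - ?P (A m) = (z *\<^sub>C m - Q m) + ?L (Q m)" by (simp add: PA)
    then have "?P (R z (z *\<^sub>C m - ?P (A m))) = ?P m + ?P (R z (?L (Q m)))"
      using R(2)[OF z] by (simp only: linR lin)
    also have "\<dots> = m" using p'(4)[OF m] p'(5)[OF Rrange[OF p(1)]] by simp
    finally show "?P (R z (z *\<^sub>C m - ?P (A m))) = m" .
  qed
qed

section \<open>Core-EP inverse, block form and solution in terms of D\<close>

context
  fixes A D :: "'a::chilbert_space \<Rightarrow> 'a" and L M :: "'a set"
  assumes A: "A \<in> bop UNIV UNIV" and gD: "gdrazin_invertible A"
  defines "D \<equiv> gdrazin A" and "L \<equiv> range D" and "M \<equiv> null_space (cadjoint D)"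
begin

private lemmas is_gdrazin = is_gdrazin_inverse_gdrazin[OF A gD, folded D_def]
private lemmas d = is_gdrazin_inverseD[OF is_gdrazin]
private lemmas dec = orth_decomposition_range_gdrazin[OF A is_gdrazin, folded M_def L_def]
private lemmas p = orth_proj_simps[OF dec]
private lemmas p' = orth_proj_simps[OF orth_decomposition_sym[OF dec]]
private lemmas P = orth_proj_bop[OF dec]
private lemmas lin = bop_UNIV_linear[OF A] bop_UNIV_linear[OF d(1)] bop_UNIV_linear[OF P]

private lemma range_gdrazin_simps:
  assumes "x \<in> L"
  shows "A x \<in> L" "D (A x) = x" "A (D x) = x"
  using assms by (auto simp: L_def d(2,3))

private lemma gdrazin_in: "D x \<in> L"
  by (simp add: L_def)

lemma core_EP_eq: "core_EP A = (\<lambda>x. D (orth_proj L x))"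
  unfolding core_EP_def D_def[symmetric] L_def[symmetric]
proof (rule the_equality)
  show "(\<lambda>x. D (orth_proj L x)) \<in> bop UNIV UNIV \<and>
      A \<circ> (\<lambda>x. D (orth_proj L x)) = orth_proj L \<and> range (\<lambda>x. D (orth_proj L x)) \<subseteq> L"
    using bop_comp[OF d(1) P] gdrazin_in by (auto simp: fun_eq_iff range_gdrazin_simps p(1))
  fix B assume B: "B \<in> bop UNIV UNIV \<and> A \<circ> B = orth_proj L \<and> range B \<subseteq> L"
  show "B = (\<lambda>x. D (orth_proj L x))"
  proof
    fix x
    have "B x = D (A (B x))" using B range_gdrazin_simps(2) by (metis range_subsetD)
    then show "B x = D (orth_proj L x)" using B by (metis comp_apply)
  qed
qed

text \<open>The lower-left block vanishes because L is invariant under A. Only values on the source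
  subspace count, so A itself can stand for its restriction to L.\<close>

lemma core_EP_form_exists: "core_EP_form A A (\<lambda>x. orth_proj L (A x)) (\<lambda>x. orth_proj M (A x))"
  unfolding core_EP_form_def Let_def D_def[symmetric] L_def[symmetric] M_def[symmetric]
proof (intro conjI)
  show "A \<in> bop L L" by (rule bop_restrict[OF A]) (auto simp: range_gdrazin_simps)
  show "(\<lambda>x. orth_proj L (A x)) \<in> bop M L"
    by (rule bop_restrict[OF bop_comp[OF P A]]) (auto simp: p(1))
  show "(\<lambda>x. orth_proj M (A x)) \<in> bop M M"
    by (rule bop_restrict[OF bop_comp[OF orth_proj_bop[OF orth_decomposition_sym[OF dec]] A]])
      (auto simp: p(2))
  show "A = block_op L M A (\<lambda>x. orth_proj L (A x)) (\<lambda>_. 0) (\<lambda>x. orth_proj M (A x))"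
  proof
    fix x
    have "A x = A (orth_proj L x) + A (orth_proj M x)"
      using lin(1)[of "orth_proj L x" "orth_proj M x"] p(3) by simp
    also have "\<dots> = A (orth_proj L x) + (orth_proj L (A (orth_proj M x)) + orth_proj M (A (orth_proj M x)))"
      by (simp only: p(3))
    finally show "A x = block_op L M A (\<lambda>x. orth_proj L (A x)) (\<lambda>_. 0) (\<lambda>x. orth_proj M (A x)) x"
      by (simp add: block_op_def Let_def add.assoc)
  qed
  have "D \<in> bop L L" by (rule bop_restrict[OF d(1)]) (auto simp: gdrazin_in)
  then show "invertible_on L A"
    unfolding invertible_on_def using range_gdrazin_simps by blast
  show "quasinilpotent_on M (\<lambda>x. orth_proj M (A x))"
    using quasinilpotent_compression[OF A is_gdrazin] dec unfolding L_def by blast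
qed

text \<open>The block identity forces A1 = A on L and the projection of A to L for A2 on M, so the
  inverse of A1 is D on L. The entry D on L fits the single formula because Du = DDAu for u in
  L.\<close>

lemma block_solution_eq:
  assumes "core_EP_form A A1 A2 A3"
  shows "block_op L M (inv_into L A1) (inv_into L A1 ^^ 2 \<circ> A2) (\<lambda>_. 0) (\<lambda>_. 0)
    = (\<lambda>x. D (D (orth_proj L (A x))))"
proof
  fix x
  from assms have A1: "A1 \<in> bop L L" and A2: "A2 \<in> bop M L" and A3: "A3 \<in> bop M M"
    and blk: "A = block_op L M A1 A2 (\<lambda>_. 0) A3"
    unfolding core_EP_form_def Let_def D_def[symmetric] L_def[symmetric] M_def[symmetric] by blast+
  have 0: "0 \<in> L" "0 \<in> M"
    using dec complex_vector.subspace_0 unfolding orth_decomposition_def by blast+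
  \<comment> \<open>Evaluating the matrix on L or M feeds 0 into the entries of the other
    column.\<close>
  have zero: "T 0 = 0" if "T \<in> bop U V" "0 \<in> U" for T :: "'a \<Rightarrow> 'a" and U V
    using that complex_vector.scale_zero_left unfolding bop_def by (metis (mono_tags, lifting) mem_Collect_eq)
  have A_eq: "A y = A1 (orth_proj L y) + A2 (orth_proj M y) + A3 (orth_proj M y)" for y
    by (subst blk) (simp add: block_op_def Let_def)
  have A1_eq: "A1 u = A u" if "u \<in> L" for u
    by (simp add: A_eq[of u] p(4)[OF that] p'(5)[OF that] zero[OF A2] zero[OF A3] 0)
  have A2_eq: "A2 v = orth_proj L (A v)" if "v \<in> M" for v
  proof -
    have "A2 v \<in> L" "A3 v \<in> M" using A2 A3 that by (auto simp: bop_def)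
    then show ?thesis
      by (simp add: A_eq[of v] p(5)[OF that] p'(4)[OF that] zero[OF A1] 0 lin p(4,5))
  qed
  \<comment> \<open>\<open>inv_into\<close> picks some preimage in L; injectivity of A1 on L, with
    left inverse D, leaves only D u.\<close>
  have J: "inv_into L A1 u = D u" if "u \<in> L" for u
  proof (rule inv_into_f_eq)
    show "inj_on A1 L" by (rule inj_on_inverseI[of _ D]) (simp add: A1_eq range_gdrazin_simps)
  qed (simp_all add: A1_eq gdrazin_in range_gdrazin_simps that)
  let ?u = "orth_proj L x" and ?v = "orth_proj M x"
  have "block_op L M (inv_into L A1) (inv_into L A1 ^^ 2 \<circ> A2) (\<lambda>_. 0) (\<lambda>_. 0) x
      = D ?u + D (D (orth_proj L (A ?v)))"
    by (simp add: block_op_def Let_def numeral_2_eq_2 A2_eq p(2) J p(1) gdrazin_in)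
  also have "D ?u = D (D (orth_proj L (A ?u)))"
    by (simp add: p(4) range_gdrazin_simps p(1))
  also have "\<dots> + D (D (orth_proj L (A ?v))) = D (D (orth_proj L (A (?u + ?v))))"
    by (simp only: lin)
  finally show "block_op L M (inv_into L A1) (inv_into L A1 ^^ 2 \<circ> A2) (\<lambda>_. 0) (\<lambda>_. 0) x
      = D (D (orth_proj L (A x)))" by (simp only: p(3))
qed

text \<open>Any solution satisfies \<open>B = (AB)B\<close> with \<open>R(AB) \<subseteq> L\<close>, so it is determined by \<open>AB\<close>,
  \<open>A\<close> being injective on \<open>L\<close>.\<close>

lemma solution_iff:
  "B \<in> bop UNIV UNIV \<and> A \<circ> B ^^ 2 = B \<and> A \<circ> B = core_EP A \<circ> A
    \<longleftrightarrow> B = (\<lambda>x. D (D (orth_proj L (A x))))" (is "?solves \<longleftrightarrow> B = ?B")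
proof
  assume ?solves
  then have B: "A (B (B x)) = B x" "A (B x) = D (orth_proj L (A x))" for x
    unfolding core_EP_eq by (auto simp: fun_eq_iff numeral_2_eq_2)
  show "B = ?B"
  proof
    fix x
    have "B x \<in> L" using B gdrazin_in by metis
    then show "B x = ?B x" using range_gdrazin_simps(2) B(2) by metis
  qed
next
  assume B: "B = ?B"
  have "B \<in> bop UNIV UNIV"
    unfolding B by (rule bop_comp[OF d(1) bop_comp[OF d(1) bop_comp[OF P A]]])
  then show ?solves
    unfolding core_EP_eq
    by (auto simp: B fun_eq_iff numeral_2_eq_2 range_gdrazin_simps gdrazin_in p(4))
qed

end

theorem corollary2p1:
  fixes A :: "'a::chilbert_space \<Rightarrow> 'a"
  assumes infinite_dimensional:
      "\<not> (\<exists>S :: 'a set. finite S \<and> complex_vector.span S = UNIV)"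
    and A: "A \<in> bop UNIV UNIV"
    and gD: "gdrazin_invertible A"
  shows "let L = range (gdrazin A); M = null_space (cadjoint (gdrazin A));
             solves = (\<lambda>B. B \<in> bop UNIV UNIV \<and> A \<circ> B ^^ 2 = B \<and> A \<circ> B = core_EP A \<circ> A)
         in orth_decomposition L M
          \<and> (\<exists>!B. solves B)
          \<and> (\<exists>A1 A2 A3. core_EP_form A A1 A2 A3)
          \<and> (\<forall>A1 A2 A3. core_EP_form A A1 A2 A3 \<longrightarrow>
               solves (block_op L M (inv_into L A1) (inv_into L A1 ^^ 2 \<circ> A2) (\<lambda>_. 0) (\<lambda>_. 0)))"
proof -
  show ?thesis
    \<comment> \<open>With \<open>solves\<close> rewritten as equality to one explicit operator,
      existence and uniqueness are immediate, and the matrix formula needs only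
      \<open>block_solution_eq\<close>.\<close>
    unfolding Let_def solution_iff[OF A gD]
    using orth_decomposition_range_gdrazin[OF A is_gdrazin_inverse_gdrazin[OF A gD]] core_EP_form_exists[OF A gD] block_solution_eq[OF A gD] by blast
qed

end
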